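(* Let $n\ge1$, let $G_n$ be the linear crossed polyomino chain with $n$ four-order complete graphs, and let $\mathcal{L}_A=\mathcal{L}_{11}+\mathcal{L}_{12}$, where $\mathcal{L}_{11}$ (resp. $\mathcal{L}_{12}$) is the $(n+1)\times(n+1)$ submatrix of the normalized Laplacian $\mathcal{L}(G_n)$ with rows indexed by $1,\ldots,n+1$ and columns indexed by $1,\ldots,n+1$ (resp. by $1',\ldots,(n+1)'$, in this order). Let $0=\gamma_1<\gamma_2\le\cdots\le\gamma_{n+1}$ be the eigenvalues of $\mathcal{L}_A$. Then $$\sum_{i=2}^{n+1}\frac1{\gamma_i}=\frac{n(25n^2+15n+14)}{12(5n+1)}.$$
   Context: For $n\geq1$, $G_n$ is the simple graph with vertex set $\{1,\ldots,n+1\}\cup\{1',\ldots,(n+1)'\}$ and edge set consisting of the vertical edges $ii'$ for $1\le i\le n+1$ together with, for each $1\le i\le n$, the edges $i(i+1)$, $i'(i+1)'$, $i(i+1)'$, $i'(i+1)$. The normalized Laplacian is $\mathcal{L}(G)=D^{-1/2}(D-A)D^{-1/2}$, i.e. its $(u,v)$ entry is $1$ if $u=v$, $-1/\sqrt{d_ud_v}$ if $u\ne v$ are adjacent, and $0$ otherwise ($d_u$ the degree of $u$). *)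

theory Defs
  imports Complex_Main "Jordan_Normal_Form.Char_Poly"
begin

text \<open>A simple graph is given by its set of edges, each edge being a two-element set of vertices.\<close>

definition degree_of :: "'v set set \<Rightarrow> 'v \<Rightarrow> nat" where
  "degree_of E v = card {e \<in> E. v \<in> e}"

definition normalized_laplacian :: "'v set set \<Rightarrow> 'v \<Rightarrow> 'v \<Rightarrow> real" where
  "normalized_laplacian E u v =
     (if u = v then 1
      else if {u, v} \<in> E then - 1 / sqrt (real (degree_of E u) * real (degree_of E v))
      else 0)"

text \<open>The vertices \<open>i\<close> and \<open>i'\<close> are written \<open>Plain i\<close> and \<open>Primed i\<close>.\<close>

datatype vertex = Plain nat | Primed nat

text \<open>The vertex set \<open>{1..n+1} \<union> {1'..(n+1)'}\<close> is the union of the edges, by the vertical edges.\<close>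

definition crossed_chain_edges :: "nat \<Rightarrow> vertex set set" where
  "crossed_chain_edges n =
     (\<Union>i\<in>{1..n+1}. {{Plain i, Primed i}}) \<union>
     (\<Union>i\<in>{1..n}. {{Plain i, Plain (i+1)}, {Primed i, Primed (i+1)},
                    {Plain i, Primed (i+1)}, {Primed i, Plain (i+1)}})"

text \<open>Matrix positions start at \<open>0\<close>, vertex numbers at \<open>1\<close>.\<close>

definition L11 :: "nat \<Rightarrow> real mat" where
  "L11 n = mat (n+1) (n+1)
     (\<lambda>(i, j). normalized_laplacian (crossed_chain_edges n) (Plain (i+1)) (Plain (j+1)))"

definition L12 :: "nat \<Rightarrow> real mat" where
  "L12 n = mat (n+1) (n+1)
     (\<lambda>(i, j). normalized_laplacian (crossed_chain_edges n) (Plain (i+1)) (Primed (j+1)))"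

definition LA :: "nat \<Rightarrow> real mat" where
  "LA n = L11 n + L12 n"

text \<open>\<open>g 1 \<le> \<dots> \<le> g m\<close> are the eigenvalues of the \<open>m \<times> m\<close> matrix \<open>A\<close>, repeated according to
  their multiplicity; in particular all complex eigenvalues of \<open>A\<close> are real.\<close>

definition ordered_eigenvalues :: "real mat \<Rightarrow> (nat \<Rightarrow> real) \<Rightarrow> bool" where
  "ordered_eigenvalues A g \<longleftrightarrow>
     char_poly A = (\<Prod>i=1..dim_row A. [:- g i, 1:]) \<and> mono_on {1..dim_row A} g"

end

theory Submission
  imports Defs
begin

text \<open>The matrix is tridiagonal, so its characteristic polynomial \<open>P\<close> is obtained from the three-term
  recurrence \<open>p (k+1) = (x - 4/5) p k - 4/25 p (k-1)\<close> with modified first and last steps. The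
  recurrence shows that \<open>Im z * Im (p (k+1) (z) * cnj (p k (z)))\<close> stays positive for non-real
  \<open>z\<close>, and that \<open>(-1)^k p k (x)\<close> stays positive for \<open>x < 0\<close>; hence all roots of \<open>P\<close> are real and
  nonnegative. It also gives the three lowest coefficients in closed form: \<open>P = c\<^sub>1 x + c\<^sub>2 x\<^sup>2 + \<dots>\<close>
  with \<open>c\<^sub>1 \<noteq> 0\<close>, so that \<open>0\<close> is a simple root and the reciprocals of the other roots add up to
  \<open>- c\<^sub>2 / c\<^sub>1\<close>.\<close>

section \<open>Determinants of tridiagonal matrices\<close>

text \<open>Laplace expansion along the last row leaves two terms. The minor \<open>B\<close> of the
  off-diagonal one has a single nonzero entry in its last column, so a second expansion reduces it
  to the block of size \<open>k\<close>.\<close>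

lemma det_tridiagonal:
  fixes T :: "nat \<Rightarrow> nat \<Rightarrow> 'a :: comm_ring_1"
  assumes T: "\<And>i j. i + 1 < j \<or> j + 1 < i \<Longrightarrow> T i j = 0"
  shows "det (mat (k+2) (k+2) (\<lambda>(i, j). T i j)) =
    T (k+1) (k+1) * det (mat (k+1) (k+1) (\<lambda>(i, j). T i j))
      - T (k+1) k * T k (k+1) * det (mat k k (\<lambda>(i, j). T i j))"
proof -
  define A where "A = mat (k+2) (k+2) (\<lambda>(i, j). T i j)"
  define B where "B = mat_delete A (k+1) k"
  have A: "A \<in> carrier_mat (k+2) (k+2)" by (simp add: A_def)
  have B: "B \<in> carrier_mat (k+1) (k+1)" by (simp add: A_def B_def mat_delete_def)
  have "det A = (\<Sum>j<k+2. A $$ (k+1, j) * cofactor A (k+1) j)"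
    by (rule laplace_expansion_row[OF A]) simp
  also have "\<dots> = A $$ (k+1, k+1) * cofactor A (k+1) (k+1) + A $$ (k+1, k) * cofactor A (k+1) k"
    using T by (simp add: A_def)
  also have "cofactor A (k+1) (k+1) = det (mat_delete A (k+1) (k+1))"
    by (simp add: cofactor_def flip: mult_2)
  also have "mat_delete A (k+1) (k+1) = mat (k+1) (k+1) (\<lambda>(i, j). T i j)"
    by (rule eq_matI) (auto simp: mat_delete_def A_def)
  also have "cofactor A (k+1) k = - det B"
    by (simp add: cofactor_def B_def)
  also have "det B = (\<Sum>i<k+1. B $$ (i, k) * cofactor B i k)"
    by (rule laplace_expansion_column[OF B]) simp
  also have "\<dots> = B $$ (k, k) * cofactor B k k"
    using T by (simp add: B_def A_def mat_delete_def)
  also have "cofactor B k k = det (mat_delete B k k)"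
    by (simp add: cofactor_def flip: mult_2)
  also have "mat_delete B k k = mat k k (\<lambda>(i, j). T i j)"
    by (rule eq_matI) (auto simp: mat_delete_def A_def B_def)
  finally show ?thesis
    by (simp add: A_def B_def mat_delete_def algebra_simps)
qed

section \<open>The entries of the matrix\<close>

lemma crossed_chain_adjacent:
  "{Plain i, Plain j} \<in> crossed_chain_edges n \<longleftrightarrow>
     i \<in> {1..n+1} \<and> j \<in> {1..n+1} \<and> (j = i + 1 \<or> i = j + 1)"
  "{Primed i, Primed j} \<in> crossed_chain_edges n \<longleftrightarrow>
     i \<in> {1..n+1} \<and> j \<in> {1..n+1} \<and> (j = i + 1 \<or> i = j + 1)"
  "{Plain i, Primed j} \<in> crossed_chain_edges n \<longleftrightarrow>
     i \<in> {1..n+1} \<and> j \<in> {1..n+1} \<and> (j = i \<or> j = i + 1 \<or> i = j + 1)"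
  "{Primed i, Plain j} \<in> crossed_chain_edges n \<longleftrightarrow>
     i \<in> {1..n+1} \<and> j \<in> {1..n+1} \<and> (j = i \<or> j = i + 1 \<or> i = j + 1)"
  unfolding crossed_chain_edges_def Un_iff UN_iff insert_iff empty_iff doubleton_eq_iff vertex.simps
  by (simp_all add: Bex_def) presburger+

text \<open>Every edge is a doubleton, so the edges at \<open>v\<close> correspond bijectively to
  its neighbours, which are easier to list.\<close>

lemma degree_crossed_chain:
  "degree_of (crossed_chain_edges n) v = card {w. {v, w} \<in> crossed_chain_edges n}"
proof -
  let ?E = "crossed_chain_edges n"
  have "\<exists>a b. e = {a, b}" if "e \<in> ?E" for e
    using that unfolding crossed_chain_edges_def by auto
  then have "{e \<in> ?E. v \<in> e} = (\<lambda>w. {v, w}) ` {w. {v, w} \<in> ?E}"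
    by (fastforce simp: insert_commute)
  moreover have "inj_on (\<lambda>w. {v, w}) {w. {v, w} \<in> ?E}"
    by (auto simp: inj_on_def doubleton_eq_iff)
  ultimately show ?thesis
    unfolding degree_of_def by (simp add: card_image)
qed

definition chain_degree :: "nat \<Rightarrow> nat \<Rightarrow> nat" where
  "chain_degree n i = (if i = 0 \<or> i = n then 3 else 5)"

lemma degree_chain:
  assumes "n \<ge> 1" "i \<le> n"
  shows "degree_of (crossed_chain_edges n) (Plain (i+1)) = chain_degree n i"
    and "degree_of (crossed_chain_edges n) (Primed (i+1)) = chain_degree n i"
proof -
  \<comment> \<open>\<open>N\<close> collects the columns at distance at most one from column
    \<open>i+1\<close>. Each contributes both of its vertices as neighbours, apart from the vertex
    itself: \<open>2 * card N - 1\<close> in all.\<close>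
  define N where "N = (if i = 0 then {i+1, i+2} else if i = n then {i, i+1} else {i, i+1, i+2})"
  have N: "j \<in> N \<longleftrightarrow> j \<in> {1..n+1} \<and> (j = i + 1 \<or> j = i + 2 \<or> i = j)" for j
    using assms unfolding N_def by auto
  have mem: "{w. {Plain (i+1), w} \<in> crossed_chain_edges n} = Plain ` (N - {i+1}) \<union> Primed ` N"
    "{w. {Primed (i+1), w} \<in> crossed_chain_edges n} = Primed ` (N - {i+1}) \<union> Plain ` N"
    (is "?l = ?r")
  proof -
    have "{Plain (i+1), w} \<in> crossed_chain_edges n \<longleftrightarrow> w \<in> Plain ` (N - {i+1}) \<union> Primed ` N"
      "{Primed (i+1), w} \<in> crossed_chain_edges n \<longleftrightarrow> w \<in> Primed ` (N - {i+1}) \<union> Plain ` N" for w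
      using assms by (cases w; simp add: crossed_chain_adjacent N image_iff; arith)+
    then show "{w. {Plain (i+1), w} \<in> crossed_chain_edges n} = Plain ` (N - {i+1}) \<union> Primed ` N"
      and "?l = ?r"
      by blast+
  qed
  have "finite N" "i + 1 \<in> N" and cN: "2 * card N - 1 = chain_degree n i"
    using assms by (auto simp: N_def chain_degree_def)
  moreover have "card N > 0" using \<open>finite N\<close> \<open>i + 1 \<in> N\<close> card_gt_0_iff by blast
  moreover have "card (Plain ` (N - {i+1}) \<union> Primed ` N) = card (N - {i+1}) + card N"
    using \<open>finite N\<close> by (subst card_Un_disjoint) (auto simp: card_image inj_on_def)
  moreover have "card (Primed ` (N - {i+1}) \<union> Plain ` N) = card (N - {i+1}) + card N"
    using \<open>finite N\<close> by (subst card_Un_disjoint) (auto simp: card_image inj_on_def)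
  ultimately show "degree_of (crossed_chain_edges n) (Plain (i+1)) = chain_degree n i"
    and "degree_of (crossed_chain_edges n) (Primed (i+1)) = chain_degree n i"
    unfolding degree_crossed_chain mem by simp_all
qed

text \<open>The vertical edge adds \<open>-1/d\<close> to the diagonal through \<open>L12\<close>;
  the factor 2 off the diagonal comes from a parallel and a crossing edge of equal weight.\<close>

definition LA_entry :: "nat \<Rightarrow> nat \<Rightarrow> nat \<Rightarrow> real" where
  "LA_entry n i j =
     (if i = j then 1 - 1 / chain_degree n i
      else if j = i + 1 \<or> i = j + 1 then - 2 / sqrt (chain_degree n i * chain_degree n j)
      else 0)"

lemma LA_eq_mat:
  assumes "n \<ge> 1"
  shows "LA n = mat (n+1) (n+1) (\<lambda>(i, j). LA_entry n i j)"
proof (rule eq_matI)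
  fix i j
  assume "i < dim_row (mat (n+1) (n+1) (\<lambda>(i, j). LA_entry n i j))"
    and "j < dim_col (mat (n+1) (n+1) (\<lambda>(i, j). LA_entry n i j))"
  then have ij: "i \<le> n" "j \<le> n" by auto
  then show "LA n $$ (i, j) = mat (n+1) (n+1) (\<lambda>(i, j). LA_entry n i j) $$ (i, j)"
    using degree_chain[OF assms ij(1)] degree_chain[OF assms ij(2)]
    by (auto simp: LA_def L11_def L12_def normalized_laplacian_def crossed_chain_adjacent LA_entry_def
        real_sqrt_mult)
qed (auto simp: LA_def L11_def L12_def)

section \<open>The characteristic polynomial\<close>

text \<open>For \<open>k \<ge> 1\<close> this is the characteristic polynomial of the leading \<open>k \<times> k\<close> block, as long as
  that block does not contain the last diagonal entry. The value at \<open>0\<close> is chosen such that the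
  recurrence already holds for the second block, although the first off-diagonal product is \<open>4/15\<close>
  and not \<open>4/25\<close>.\<close>

fun block_poly :: "nat \<Rightarrow> real poly" where
  "block_poly 0 = [:5/3:]"
| "block_poly (Suc 0) = [:-2/3, 1:]"
| "block_poly (Suc (Suc k)) =
     [:-4/5, 1:] * block_poly (Suc k) - Polynomial.smult (4/25) (block_poly k)"

lemma char_poly_LA:
  assumes n: "n \<ge> 1"
  shows "char_poly (LA n) = [:-2/3, 1:] * block_poly n - Polynomial.smult (4/15) (block_poly (n - 1))"
proof -
  define T where "T i j = (if i = j then [:- LA_entry n i j, 1:] else [:- LA_entry n i j:])" for i j
  define f where "f k = det (mat k k (\<lambda>(i, j). T i j))" for k
  have "char_poly_matrix (LA n) = mat (n+1) (n+1) (\<lambda>(i, j). T i j)"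
    unfolding char_poly_matrix_def LA_eq_mat[OF n] by (rule eq_matI) (auto simp: T_def)
  then have char: "char_poly (LA n) = f (Suc n)"
    by (simp add: char_poly_def f_def)
  have "T i j = 0" if "i + 1 < j \<or> j + 1 < i" for i j
    using that by (auto simp: T_def LA_entry_def)
  from det_tridiagonal[of T, OF this]
  have rec: "f (Suc (Suc k)) = T (Suc k) (Suc k) * f (Suc k) - T (Suc k) k * T k (Suc k) * f k" for k
    by (simp add: f_def)
  have f0: "f 0 = 1" by (simp add: f_def)
  have f1: "f (Suc 0) = [:-2/3, 1:]"
    by (simp add: f_def det_single T_def LA_entry_def chain_degree_def)
  have off: "T (Suc k) k * T k (Suc k) = [:4 / (chain_degree n k * chain_degree n (Suc k)):]" for k
    by (simp add: T_def LA_entry_def mult.commute)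
  have diag: "T k k = [:1 / chain_degree n k - 1, 1:]" for k
    by (simp add: T_def LA_entry_def)
  have block: "f k = block_poly k" if "1 \<le> k" "k \<le> n" for k
    using that
  proof (induction k rule: block_poly.induct)
    case (3 k)
    show ?case
    proof (cases "k = 0")
      case True
      with 3 n show ?thesis
        by (simp add: rec off diag f0 f1 chain_degree_def)
    next
      case False
      with 3 show ?thesis
        by (simp add: rec off diag chain_degree_def)
    qed
  qed (auto simp: f1)
  obtain m where m: "n = Suc m" using n by (cases n) auto
  have "f (Suc n) = [:-2/3, 1:] * block_poly n - Polynomial.smult (4/15) (block_poly (n - 1))"
  \<comment> \<open>For \<open>n = 1\<close> the only off-diagonal product is 4/9, with
    \<open>f 0 = 1\<close>. This agrees with \<open>4/15 * block_poly 0\<close>, as 4/15 * 5/3 =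
    4/9.\<close>
  proof (cases "m = 0")
    case True
    with m show ?thesis
      by (simp add: rec off diag f0 f1 chain_degree_def)
  next
    case False
    with m block[of m] block[of n] show ?thesis
      by (simp add: rec off diag chain_degree_def)
  qed
  then show ?thesis by (simp only: char)
qed

section \<open>Location of the roots: real and nonnegative\<close>

lemma poly_of_real_recurrence:
  fixes p q :: "real poly" and z :: "'a :: {real_algebra_1, field_char_0}"
  shows "poly (map_poly of_real ([:a, 1:] * p - Polynomial.smult b q)) z
    = (z + of_real a) * poly (map_poly of_real p) z - of_real b * poly (map_poly of_real q) z"
proof -
  interpret h: map_poly_inj_idom_hom "of_real :: real \<Rightarrow> 'a" ..
  show ?thesis
    unfolding h.hom_minus h.hom_mult by (simp add: hom_distribs algebra_simps)
qed

text \<open>Since \<open>p * cnj p\<close> is real, the first term contributes \<open>Im z\<close>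
  times \<open>(cmod p)\<^sup>2\<close>; swapping the conjugation in \<open>q * cnj p\<close> flips
  the sign of its imaginary part. For \<open>b > 0\<close>, positivity therefore propagates.\<close>

lemma im_recurrence:
  fixes z p q :: complex and a b :: real
  shows "Im z * Im (((z + of_real a) * p - of_real b * q) * cnj p)
    = (Im z)\<^sup>2 * (cmod p)\<^sup>2 + b * (Im z * Im (p * cnj q))"
  unfolding cmod_power2 by (simp add: algebra_simps power2_eq_square)

lemma im_block_poly:
  assumes "Im z \<noteq> 0"
  defines "P \<equiv> \<lambda>k. poly (map_poly complex_of_real (block_poly k)) z"
  shows "Im z * Im (P (Suc k) * cnj (P k)) > 0"
proof (induction k)
  case 0
  have "Im z * Im (P (Suc 0) * cnj (P 0)) = 5/3 * (Im z)\<^sup>2"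
    by (simp add: P_def power2_eq_square)
  also have "\<dots> > 0" using assms(1) by simp
  finally show ?case .
next
  case (Suc k)
  have "P (Suc (Suc k)) = (z + of_real (-4/5)) * P (Suc k) - of_real (4/25) * P k"
    by (simp only: P_def block_poly.simps poly_of_real_recurrence)
  then have "Im z * Im (P (Suc (Suc k)) * cnj (P (Suc k)))
      = (Im z)\<^sup>2 * (cmod (P (Suc k)))\<^sup>2 + 4/25 * (Im z * Im (P (Suc k) * cnj (P k)))"
    by (simp only: im_recurrence)
  then show ?case using Suc by (simp add: add_nonneg_pos)
qed

lemma char_poly_LA_nonreal:
  assumes n: "n \<ge> 1" and z: "Im z \<noteq> 0"
  shows "poly (map_poly complex_of_real (char_poly (LA n))) z \<noteq> 0"
proof -
  define P where "P = (\<lambda>k. poly (map_poly complex_of_real (block_poly k)) z)"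
  define c where "c = poly (map_poly complex_of_real (char_poly (LA n))) z"
  obtain m where m: "n = Suc m" using n by (cases n) auto
  have "c = (z + of_real (-2/3)) * P n - of_real (4/15) * P m"
    by (simp only: c_def P_def char_poly_LA[OF n] poly_of_real_recurrence) (simp add: m)
  then have "Im z * Im (c * cnj (P n))
      = (Im z)\<^sup>2 * (cmod (P n))\<^sup>2 + 4/15 * (Im z * Im (P n * cnj (P m)))"
    by (simp only: im_recurrence)
  moreover have "Im z * Im (P n * cnj (P m)) > 0"
    using im_block_poly[OF z, of m] by (simp add: P_def m)
  ultimately have "Im z * Im (c * cnj (P n)) > 0"
    by (simp add: add_nonneg_pos)
  then show ?thesis by (auto simp: c_def)
qed

text \<open>Positivity alone is not inductive. The ratio 2/5 is the double root of t^2 - 4/5 t +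
  4/25, so at \<open>x = 0\<close> the recurrence just preserves it, and the term
  \<open>- x * r (Suc k)\<close> makes the bound strict.\<close>

lemma block_poly_neg:
  assumes "x < 0"
  defines "r \<equiv> \<lambda>k. (-1) ^ k * poly (block_poly k) x"
  shows "0 < r k \<and> 2/5 * r k < r (Suc k)"
proof (induction k)
  case 0
  then show ?case using assms(1) by (simp add: r_def)
next
  case (Suc k)
  have "r (Suc (Suc k)) = 4/5 * r (Suc k) - 4/25 * r k - x * r (Suc k)"
    by (simp add: r_def algebra_simps)
  moreover have "0 < r (Suc k)" using Suc by linarith
  moreover have "x * r (Suc k) < 0"
    using \<open>0 < r (Suc k)\<close> assms(1) by (simp add: mult_neg_pos)
  ultimately show ?case using Suc by linarith
qed

lemma char_poly_LA_neg:
  assumes n: "n \<ge> 1" and x: "x < 0"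
  shows "poly (char_poly (LA n)) x \<noteq> 0"
proof -
  define r where "r = (\<lambda>k. (-1) ^ k * poly (block_poly k) x)"
  obtain m where m: "n = Suc m" using n by (cases n) auto
  have "(-1) ^ Suc n * poly (char_poly (LA n)) x = 2/3 * r n - 4/15 * r m - x * r n"
    by (simp add: r_def m char_poly_LA algebra_simps)
  moreover have r: "0 < r m" "2/5 * r m < r n"
    using block_poly_neg[OF x, of m] by (simp_all add: r_def m)
  moreover have "x * r n < 0"
    using r x by (intro mult_neg_pos) linarith+
  \<comment> \<open>The ratio bound is exactly sufficient: 4/15 \<open>r m\<close> < 2/3
    \<open>r n\<close>.\<close>
  ultimately have "(-1) ^ Suc n * poly (char_poly (LA n)) x > 0"
    by linarith
  then show ?thesis by auto
qed

section \<open>The lowest coefficients\<close>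

text \<open>Dividing by \<open>(- 2/5) ^ k\<close> turns the recurrence into one for second differences, whose
  solutions are polynomials in \<open>k\<close>.\<close>

lemma coeff_block_poly:
  "coeff (block_poly k) 0 = (- 2/5) ^ k * (5/3)"
  "coeff (block_poly k) (Suc 0) = - ((- 2/5) ^ k * ((25 * real k ^ 2 + 5 * real k) / 12))"
  "coeff (block_poly k) (Suc (Suc 0)) =
     (- 2/5) ^ k * (25/288 * (5 * real k ^ 4 + 2 * real k ^ 3 - 5 * real k ^ 2 - 2 * real k))"
proof (induction k rule: block_poly.induct)
  case (3 k)
  {
    case 1
    show ?case using 3 by simp
  next
    case 2
    show ?case using 3 by (simp add: field_simps power2_eq_square)
  next
    case 3
    show ?case using "3.IH" by (simp add: field_simps power_numeral_reduce)
  }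
qed simp_all

lemma coeff_char_poly_LA:
  assumes n: "n \<ge> 1"
  shows "coeff (char_poly (LA n)) 0 = 0"
    and "coeff (char_poly (LA n)) (Suc 0) = (- 2/5) ^ n * (5/9 * (5 * real n + 1))"
    and "coeff (char_poly (LA n)) (Suc (Suc 0)) =
      - ((- 2/5) ^ n * (5/108 * (real n * (25 * real n ^ 2 + 15 * real n + 14))))"
proof -
  obtain m where m: "n = Suc m" using n by (cases n) auto
  show "coeff (char_poly (LA n)) 0 = 0"
    by (simp add: m char_poly_LA coeff_block_poly)
  show "coeff (char_poly (LA n)) (Suc 0) = (- 2/5) ^ n * (5/9 * (5 * real n + 1))"
    by (simp add: m char_poly_LA coeff_block_poly field_simps power2_eq_square)
  show "coeff (char_poly (LA n)) (Suc (Suc 0)) =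
      - ((- 2/5) ^ n * (5/108 * (real n * (25 * real n ^ 2 + 15 * real n + 14))))"
    by (simp add: m char_poly_LA coeff_block_poly field_simps power_numeral_reduce)
qed

section \<open>Eigenvalues\<close>

text \<open>The polynomial splits over the complex numbers; its roots being real, the factorization
  is the image of a real one, and the embedding of real polynomials is injective.\<close>

lemma real_rooted_splits:
  fixes p :: "real poly"
  assumes p: "lead_coeff p = 1"
    and real: "\<And>z. poly (map_poly complex_of_real p) z = 0 \<Longrightarrow> Im z = 0"
  shows "\<exists>bs. p = (\<Prod>b\<leftarrow>bs. [:- b, 1:]) \<and> length bs = degree p"
proof -
  let ?h = "map_poly complex_of_real"
  interpret h: map_poly_inj_idom_hom complex_of_real ..
  from fundamental_theorem_algebra_factorized[of "?h p"] obtain as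
    where "Polynomial.smult (lead_coeff (?h p)) (\<Prod>a\<leftarrow>as. [:- a, 1:]) = ?h p"
      and len: "length as = degree p"
    by auto
  then have as: "?h p = (\<Prod>a\<leftarrow>as. [:- a, 1:])"
    using p by simp
  have "Im a = 0" if "a \<in> set as" for a
    using that by (intro real) (auto simp: as poly_prod_list prod_list_zero_iff)
  then have "as = map complex_of_real (map Re as)"
    by (simp add: map_idI complex_eq_iff)
  then obtain bs where bs: "as = map complex_of_real bs" ..
  have "?h p = ?h (\<Prod>b\<leftarrow>bs. [:- b, 1:])"
    by (simp add: as bs h.hom_prod_list comp_def)
  then show ?thesis using len bs by auto
qed

lemma ordered_eigenvalues_exist:
  assumes n: "n \<ge> 1"
  shows "\<exists>\<gamma>. ordered_eigenvalues (LA n) \<gamma>"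
proof -
  have A: "LA n \<in> carrier_mat (n+1) (n+1)" by (simp add: LA_def L11_def L12_def)
  have "lead_coeff (char_poly (LA n)) = 1"
    using degree_monic_char_poly[OF A] by simp
  then obtain bs where bs: "char_poly (LA n) = (\<Prod>b\<leftarrow>bs. [:- b, 1:])" "length bs = n + 1"
    using real_rooted_splits[of "char_poly (LA n)"] char_poly_LA_nonreal[OF n]
      degree_monic_char_poly[OF A] by metis
  \<comment> \<open>Eigenvalues are numbered from 1, list positions from 0.\<close>
  define g where "g i = sort bs ! (i - 1)" for i
  have "(\<Prod>b\<leftarrow>bs. [:- b, 1:]) = (\<Prod>b\<leftarrow>sort bs. [:- b, 1:])"
    by (metis (mono_tags) mset_map mset_sort prod_mset_prod_list)
  also have "\<dots> = (\<Prod>i<n+1. [:- (sort bs ! i), 1:])"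
    using bs(2) by (simp add: prod.list_conv_set_nth atLeast0LessThan)
  also have "\<dots> = (\<Prod>i=1..n+1. [:- g i, 1:])"
    by (rule prod.reindex_bij_witness[of _ "\<lambda>i. i - 1" Suc]) (auto simp: g_def)
  finally have "char_poly (LA n) = (\<Prod>i=1..n+1. [:- g i, 1:])"
    using bs(1) by simp
  moreover have "mono_on {1..n+1} g"
    unfolding g_def using bs(2) by (auto intro!: mono_onI sorted_nth_mono)
  ultimately show ?thesis
    using A unfolding ordered_eigenvalues_def by (intro exI[of _ g]) auto
qed

text \<open>This is the logarithmic derivative of the product, evaluated at 0, with denominators
  cleared.\<close>

lemma sum_inverse_roots:
  fixes g :: "'b \<Rightarrow> 'a :: field"
  assumes "finite S" "\<And>i. i \<in> S \<Longrightarrow> g i \<noteq> 0"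
  defines "q \<equiv> \<lambda>S. \<Prod>i\<in>S. [:- g i, 1:]"
  shows "coeff (q S) (Suc 0) = - coeff (q S) 0 * (\<Sum>i\<in>S. 1 / g i)"
  using assms(1,2)
proof (induction S rule: finite_induct)
  case (insert x S)
  then show ?case by (simp add: q_def field_simps)
qed (simp add: q_def)

theorem theorem3p4:
  fixes n :: nat
  assumes "n \<ge> 1"
  shows "(\<exists>\<gamma>. ordered_eigenvalues (LA n) \<gamma>) \<and>
    (\<forall>\<gamma>. ordered_eigenvalues (LA n) \<gamma> \<longrightarrow>
       \<gamma> 1 = 0 \<and> 0 < \<gamma> 2 \<and>
       (\<Sum>i=2..n+1. 1 / \<gamma> i)
         = real n * (25 * real n ^ 2 + 15 * real n + 14) / (12 * (5 * real n + 1)))"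
proof (intro conjI allI impI ordered_eigenvalues_exist[OF assms])
  fix \<gamma>
  assume \<gamma>: "ordered_eigenvalues (LA n) \<gamma>"
  define P where "P = char_poly (LA n)"
  define Q where "Q = (\<Prod>i=2..n+1. [:- \<gamma> i, 1:])"
  have P: "P = (\<Prod>i=1..n+1. [:- \<gamma> i, 1:])" and mono: "mono_on {1..n+1} \<gamma>"
    using \<gamma> by (simp_all add: ordered_eigenvalues_def P_def LA_def L11_def L12_def)
  have root: "poly P x = 0 \<longleftrightarrow> (\<exists>i\<in>{1..n+1}. \<gamma> i = x)" for x
    unfolding P poly_prod prod_zero_iff[OF finite_atLeastAtMost] by (intro bex_cong) auto
  have nonneg: "\<gamma> i \<ge> 0" if "i \<in> {1..n+1}" for i
    using root[of "\<gamma> i"] that char_poly_LA_neg[OF assms, of "\<gamma> i"] unfolding P_def by force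
  have "poly P 0 = 0"
    using coeff_char_poly_LA(1)[OF assms] by (simp add: P_def poly_0_coeff_0)
  then obtain j where j: "j \<in> {1..n+1}" "\<gamma> j = 0"
    using root by blast
  \<comment> \<open>Zero is a root and no root is negative, so the least one is zero.\<close>
  have "\<gamma> 1 \<le> \<gamma> j"
    using j by (intro mono_onD[OF mono]) auto
  with j nonneg[of 1] show g1: "\<gamma> 1 = 0" by simp
  have "P = (\<Prod>i\<in>insert 1 {2..n+1}. [:- \<gamma> i, 1:])"
    unfolding P by (rule prod.cong) auto
  also have "\<dots> = [:0, 1:] * Q"
    unfolding Q_def using g1 by (subst prod.insert) (simp_all del: prod.cl_ivl_Suc mult_pCons_left)
  finally have PQ: "P = [:0, 1:] * Q" .
  have Q0: "coeff Q 0 = (- 2/5) ^ n * (5/9 * (5 * real n + 1))"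
    and Q1: "coeff Q (Suc 0) =
      - ((- 2/5) ^ n * (5/108 * (real n * (25 * real n ^ 2 + 15 * real n + 14))))"
    using coeff_char_poly_LA(2,3)[OF assms] by (simp_all add: P_def[symmetric] PQ)
  \<comment> \<open>A nonzero constant term of \<open>Q\<close> means that 0 is a simple root of
    \<open>P\<close>, so the remaining roots have reciprocals.\<close>
  have "coeff Q 0 \<noteq> 0" unfolding Q0 by simp
  then have nz: "\<gamma> i \<noteq> 0" if "i \<in> {2..n+1}" for i
    using that unfolding Q_def by (auto simp: poly_0_coeff_0[symmetric] poly_prod simp del: prod.cl_ivl_Suc)
  show "0 < \<gamma> 2"
    using nz[of 2] nonneg[of 2] assms by force
  have "coeff Q (Suc 0) = - coeff Q 0 * (\<Sum>i=2..n+1. 1 / \<gamma> i)"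
    unfolding Q_def by (rule sum_inverse_roots) (use nz in auto)
  then have "(\<Sum>i=2..n+1. 1 / \<gamma> i) = - coeff Q (Suc 0) / coeff Q 0"
    using \<open>coeff Q 0 \<noteq> 0\<close> by (simp add: field_simps)
  also have "\<dots> = real n * (25 * real n ^ 2 + 15 * real n + 14) / (12 * (5 * real n + 1))"
    unfolding Q0 Q1 by (simp add: divide_simps)
  finally show "(\<Sum>i=2..n+1. 1 / \<gamma> i)
      = real n * (25 * real n ^ 2 + 15 * real n + 14) / (12 * (5 * real n + 1))" .
qed

end
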